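(* There exist uncountably many totally irrational $\underline{x}\in\mathbb R^2$ for which some tail of the sequence of best approximations (with respect to the maximum norm) lies in $\mathcal H_1\cup\mathcal H_2$, where $\mathcal H_1=\{(x,y,z)\in\mathbb Z^3:y=0\}$ and $\mathcal H_2=\{(x,y,z)\in\mathbb Z^3:x=0\}$. Moreover, for such $\underline{x}$ the best approximations of large norm lie alternately in $\mathcal H_1$ and $\mathcal H_2$. Furthermore, for any given $w\in[2,\infty]$, $\underline{x}$ can be chosen with these properties and additionally $\hat\omega(\underline{x})=w$.
   Context: For $\underline{x}=(\xi_1,\xi_2)$ write $\underline{x}^*=(\xi_1,\xi_2,1)$ and for $\mathbf y\in\mathbb R^3$ let $\hat{\mathbf y}$ be its first two coordinates; $\Vert\cdot\Vert$ is the maximum norm. $\underline{x}$ is totally irrational if $\mathbf q\cdot\underline{x}^*\ne0$ for all nonzero $\mathbf q\in\mathbb Z^3$. $\mathbf q\in\mathbb Z^3$ is a best approximation if $|\mathbf q\cdot\underline{x}^*|=\min\{|\mathbf b\cdot\underline{x}^*|:\mathbf b\in\mathbb Z^3,0<\Vert\hat{\mathbf b}\Vert\le\Vert\hat{\mathbf q}\Vert\}$; ordered by increasing norm they form the sequence of best approximations. $\hat\omega(\underline{x})=\sup\{t>0:\limsup_{Q\to\infty}Q^t\min_{\mathbf b\in\mathbb Z^3,0<\Vert\hat{\mathbf b}\Vert\le Q}|\mathbf b\cdot\underline{x}^*|<\infty\}$. *)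

theory Defs
  imports "HOL-Analysis.Analysis"
begin

text \<open>Integer vectors in \<open>\<int>\<^sup>3\<close> are triples of type \<open>int \<times> int \<times> int\<close>.\<close>

fun hat :: "int \<times> int \<times> int \<Rightarrow> int \<times> int" where
  "hat (a, b, c) = (a, b)"

fun max_norm :: "int \<times> int \<Rightarrow> int" where
  "max_norm (a, b) = max \<bar>a\<bar> \<bar>b\<bar>"

text \<open>The product \<open>q \<cdot> x\<^sup>*\<close> with \<open>x\<^sup>* = (\<xi>\<^sub>1, \<xi>\<^sub>2, 1)\<close>.\<close>

fun dot_star :: "int \<times> int \<times> int \<Rightarrow> real \<times> real \<Rightarrow> real" where
  "dot_star (a, b, c) (\<xi>1, \<xi>2) = of_int a * \<xi>1 + of_int b * \<xi>2 + of_int c"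

definition totally_irrational :: "real \<times> real \<Rightarrow> bool" where
  "totally_irrational x \<longleftrightarrow> (\<forall>q. q \<noteq> 0 \<longrightarrow> dot_star q x \<noteq> 0)"

text \<open>
  The set below is nonempty for \<open>Q \<ge> 1\<close>, and its infimum is then a minimum: there are
  finitely many choices for \<open>hat b\<close>, and for each of them the possible values
  of \<open>b \<cdot> x\<^sup>*\<close> form a translate of \<open>\<int>\<close>. For \<open>Q < 1\<close> the set is empty and the value is
  meaningless.
\<close>

definition min_value :: "real \<times> real \<Rightarrow> real \<Rightarrow> real" where
  "min_value x Q =
     Inf {\<bar>dot_star b x\<bar> | b. 0 < max_norm (hat b) \<and> of_int (max_norm (hat b)) \<le> Q}"

definition best_approximation :: "real \<times> real \<Rightarrow> int \<times> int \<times> int \<Rightarrow> bool" where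
  "best_approximation x q \<longleftrightarrow>
     0 < max_norm (hat q) \<and> \<bar>dot_star q x\<bar> = min_value x (of_int (max_norm (hat q)))"

text \<open>
  If \<open>q\<close> is a best approximation then so is \<open>- q\<close>, and for totally irrational \<open>x\<close> there are no
  others of the same norm. The sequence of best approximations therefore lists one
  representative of each pair \<open>\<plusminus>q\<close>; the choice of signs is left open.
\<close>

definition best_approximation_seq ::
    "real \<times> real \<Rightarrow> (nat \<Rightarrow> int \<times> int \<times> int) \<Rightarrow> bool" where
  "best_approximation_seq x q \<longleftrightarrow>
     (\<forall>k. best_approximation x (q k)) \<and>
     strict_mono (\<lambda>k. max_norm (hat (q k))) \<and>
     (\<forall>p. best_approximation x p \<longrightarrow> (\<exists>k. p = q k \<or> p = - q k))"

definition H1 :: "(int \<times> int \<times> int) set" where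
  "H1 = {(x, y, z). y = 0}"

definition H2 :: "(int \<times> int \<times> int) set" where
  "H2 = {(x, y, z). x = 0}"

definition special_points :: "(real \<times> real) set" where
  "special_points =
     {x. totally_irrational x \<and>
         (\<exists>q. best_approximation_seq x q \<and> (\<exists>N. \<forall>k\<ge>N. q k \<in> H1 \<union> H2))}"

definition uniform_exponent :: "real \<times> real \<Rightarrow> ereal" where
  "uniform_exponent x =
     Sup {ereal t | t. 0 < t \<and>
            Limsup at_top (\<lambda>Q::real. ereal (Q powr t * min_value x Q)) < \<infinity>}"

end

theory Submission
  imports Defs "HOL-Real_Asymp.Real_Asymp"
begin

text \<open>
  Let \<open>X\<close> be a sequence of positive integers such that consecutive terms are coprime,
  \<open>X (k+2) \<ge> 3 X (k+1)\<^sup>2\<close> and \<open>X (k+4) \<equiv> X k\<close> modulo \<open>X (k+2)\<close>. The last condition makes the terms of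
  even index, and those of odd index, denominators of convergents of real numbers \<open>\<xi>\<^sub>1\<close> and \<open>\<xi>\<^sub>2\<close>,
  which gives vectors of norm \<open>X k\<close> alternately in \<open>H1\<close> and \<open>H2\<close>. If \<open>|u|, |v| < X (k+1)\<close> and
  \<open>v \<noteq> 0\<close>, then replacing the two numbers by their convergents with denominators \<open>X k\<close> and
  \<open>X (k+1)\<close> turns a linear form with coefficients \<open>u, v\<close> into a rational number with denominator
  \<open>X k * X (k+1)\<close>. It is nonzero by coprimality, and the growth condition makes the error of
  the replacement too small for the form to beat the \<open>k\<close>-th vector. So these vectors are, up to
  sign, all the best approximations of large norm. The minimal value on \<open>[X k, X (k+1))\<close> is
  of order \<open>1 / X (k+2)\<close>, so prescribing the size of \<open>X (k+2)\<close> in terms of \<open>X (k+1)\<close> prescribes the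
  uniform exponent; the congruences leave this size free up to \<open>X (k+1)\<^sup>2\<close>. Uncountability follows
  because uncountably many exponents occur.

  Alternation is forced for every special point: two successive best approximations in the same
  plane have \<open>|q\<^sub>k \<cdot> x\<^sup>*| \<ge> 1 / (2 \<parallel>q\<^sub>k\<^sub>+\<^sub>1\<parallel>)\<close>, whereas Dirichlet's theorem gives an upper bound of
  order \<open>\<parallel>q\<^sub>k\<^sub>+\<^sub>1\<parallel>\<^sup>-\<^sup>2\<close>.
\<close>

subsection \<open>Best approximations\<close>

text \<open>Keeps quantifiers over integer vectors intact instead of splitting them into three
  coordinates, so facts about whole vectors stay applicable.\<close>

declare split_paired_All [simp del] split_paired_Ex [simp del]

lemma max_norm_nonneg: "0 \<le> max_norm h"
  by (cases h) auto

lemma max_norm_hat_uminus [simp]: "max_norm (hat (- q)) = max_norm (hat q)"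
  by (cases q) auto

lemma dot_star_uminus [simp]: "dot_star (- q) x = - dot_star q x"
  by (cases q; cases x) auto

lemma dot_star_add: "dot_star (p + q) x = dot_star p x + dot_star q x"
  by (cases p; cases q; cases x) (auto simp: algebra_simps)

lemma dot_star_diff: "dot_star (p - q) x = dot_star p x - dot_star q x"
  by (cases p; cases q; cases x) (auto simp: algebra_simps)

lemma H12_uminus: "- q \<in> H1 \<union> H2 \<longleftrightarrow> q \<in> H1 \<union> H2"
  by (cases q) (auto simp: H1_def H2_def)

lemma min_value_le:
  assumes "0 < max_norm (hat b)" "of_int (max_norm (hat b)) \<le> Q"
  shows "min_value x Q \<le> \<bar>dot_star b x\<bar>"
  unfolding min_value_def
proof (rule cInf_lower)
  show "bdd_below {\<bar>dot_star b x\<bar> |b. 0 < max_norm (hat b) \<and> real_of_int (max_norm (hat b)) \<le> Q}"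
    by (rule bdd_belowI[of _ 0]) auto
qed (use assms in blast)

lemma min_value_greatest:
  assumes "1 \<le> Q"
    and "\<And>b. 0 < max_norm (hat b) \<Longrightarrow> of_int (max_norm (hat b)) \<le> Q \<Longrightarrow> c \<le> \<bar>dot_star b x\<bar>"
  shows "c \<le> min_value x Q"
  unfolding min_value_def
proof (rule cInf_greatest)
  \<comment> \<open>An infimum over the empty set would be meaningless; from
    \<open>1 \<le> Q\<close> on, the first unit vector is admissible.\<close>
  have "0 < max_norm (hat (1, 0, 0))" "of_int (max_norm (hat (1, 0, 0))) \<le> Q"
    using assms(1) by auto
  then show "{\<bar>dot_star b x\<bar> |b. 0 < max_norm (hat b) \<and> real_of_int (max_norm (hat b)) \<le> Q} \<noteq> {}"
    by blast
qed (use assms in auto)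

lemma best_approximationI:
  assumes "0 < max_norm (hat q)"
    and "\<And>b. 0 < max_norm (hat b) \<Longrightarrow> max_norm (hat b) \<le> max_norm (hat q) \<Longrightarrow>
      \<bar>dot_star q x\<bar> \<le> \<bar>dot_star b x\<bar>"
  shows "best_approximation x q"
  unfolding best_approximation_def
proof
  show "\<bar>dot_star q x\<bar> = min_value x (of_int (max_norm (hat q)))"
  proof (rule antisym)
    show "\<bar>dot_star q x\<bar> \<le> min_value x (of_int (max_norm (hat q)))"
      by (rule min_value_greatest) (use assms in auto)
  qed (rule min_value_le; use assms in simp)
qed (rule assms(1))

lemma best_approximationD:
  assumes "best_approximation x q"
  shows "0 < max_norm (hat q)"
    and "0 < max_norm (hat b) \<Longrightarrow> max_norm (hat b) \<le> max_norm (hat q) \<Longrightarrow>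
      \<bar>dot_star q x\<bar> \<le> \<bar>dot_star b x\<bar>"
  using assms min_value_le[of b "of_int (max_norm (hat q))" x]
  by (auto simp: best_approximation_def)

text \<open>Equal absolute values make the form vanish at \<open>p - q\<close> or at
  \<open>p + q\<close>. This is the source of every uniqueness up to sign below.\<close>

lemma totally_irrational_abs_eq:
  assumes "totally_irrational x" "\<bar>dot_star p x\<bar> = \<bar>dot_star q x\<bar>"
  shows "p = q \<or> p = - q"
proof -
  have "dot_star (p - q) x = 0 \<or> dot_star (p + q) x = 0"
    using assms(2) by (auto simp: dot_star_add dot_star_diff abs_if split: if_splits)
  then have "p - q = 0 \<or> p + q = 0"
    using assms(1) unfolding totally_irrational_def by blast
  then show ?thesis by (auto simp: add_eq_0_iff2)
qed

lemma best_approximation_unique: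
  assumes "totally_irrational x" "best_approximation x p" "best_approximation x q"
    and "max_norm (hat p) = max_norm (hat q)"
  shows "p = q \<or> p = - q"
  using assms by (intro totally_irrational_abs_eq[of x]) (auto simp: best_approximation_def)

text \<open>Only finitely many vectors are at most as long as \<open>b\<close> and do at least as
  well: the size of the form bounds the third coordinate. A minimiser among them is a best
  approximation.\<close>

lemma ex_best_approximation_le:
  assumes "0 < max_norm (hat b)"
  obtains p where "best_approximation x p" "max_norm (hat p) \<le> max_norm (hat b)"
    "\<bar>dot_star p x\<bar> \<le> \<bar>dot_star b x\<bar>"
proof -
  obtain s t where x: "x = (s, t)" by (cases x)
  define S where "S = {c. 0 < max_norm (hat c) \<and> max_norm (hat c) \<le> max_norm (hat b) \<and>
    \<bar>dot_star c x\<bar> \<le> \<bar>dot_star b x\<bar>}"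
  define n where "n = max_norm (hat b)"
  define m where "m = \<lceil>\<bar>dot_star b x\<bar> + of_int n * \<bar>s\<bar> + of_int n * \<bar>t\<bar>\<rceil>"
  have "S \<subseteq> {-n..n} \<times> {-n..n} \<times> {-m..m}"
  proof
    fix c assume "c \<in> S"
    moreover obtain u v z where c: "c = (u, v, z)" by (cases c)
    ultimately have uv: "\<bar>u\<bar> \<le> n" "\<bar>v\<bar> \<le> n" 
      and d: "\<bar>of_int u * s + of_int v * t + of_int z\<bar> \<le> \<bar>dot_star b x\<bar>"
      by (auto simp: S_def n_def x)
    have "\<bar>of_int u * s\<bar> \<le> of_int n * \<bar>s\<bar>" "\<bar>of_int v * t\<bar> \<le> of_int n * \<bar>t\<bar>"
      using uv by (auto simp: abs_mult intro!: mult_right_mono)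
    with d have "\<bar>of_int z\<bar> \<le> \<bar>dot_star b x\<bar> + of_int n * \<bar>s\<bar> + of_int n * \<bar>t\<bar>"
      by linarith
    then have "\<bar>z\<bar> \<le> m" unfolding m_def by linarith
    with uv show "c \<in> {-n..n} \<times> {-n..n} \<times> {-m..m}" by (auto simp: c)
  qed
  then have "finite S" by (rule finite_subset) auto
  moreover have "b \<in> S" using assms by (auto simp: S_def)
  ultimately obtain p where p: "p \<in> S" "\<And>c. c \<in> S \<Longrightarrow> \<bar>dot_star p x\<bar> \<le> \<bar>dot_star c x\<bar>"
    using ex_min_if_finite[of "(\<lambda>c. \<bar>dot_star c x\<bar>) ` S"] by fastforce
  have "best_approximation x p"
  proof (rule best_approximationI)
    fix c assume c: "0 < max_norm (hat c)" "max_norm (hat c) \<le> max_norm (hat p)"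
    show "\<bar>dot_star p x\<bar> \<le> \<bar>dot_star c x\<bar>"
      \<comment> \<open>A competitor outside \<open>S\<close> is still at most as long as
        \<open>b\<close>, so its value exceeds that of \<open>b\<close>, hence that of
        \<open>p\<close>.\<close>
      using c p unfolding S_def by (cases "c \<in> S") (auto simp: S_def)
  qed (use p in \<open>auto simp: S_def\<close>)
  with p that show ?thesis by (auto simp: S_def)
qed

section \<open>Dirichlet's bound and the forced alternation\<close>

text \<open>Pigeonhole: the fractional parts of \<open>i * s + j * t\<close> at
  \<open>(N + 1)^2\<close> grid points fall into \<open>N^2\<close> intervals of length
  \<open>1 / N^2\<close>; two in the same interval give \<open>b\<close> as their
  difference.\<close>

lemma dirichlet_linear_form:
  fixes N :: nat
  assumes "0 < N"
  obtains b where "0 < max_norm (hat b)" "max_norm (hat b) \<le> int N"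
    "\<bar>dot_star b x\<bar> < 1 / real N ^ 2"
proof -
  obtain s t where x: "x = (s, t)" by (cases x)
  define g where "g = (\<lambda>(i::nat, j::nat). real i * s + real j * t)"
  define f where "f = (\<lambda>p. \<lfloor>real N ^ 2 * frac (g p)\<rfloor>)"
  have f: "f p \<in> {0..<int (N^2)}" for p
  proof -
    have "real N ^ 2 * frac (g p) < real N ^ 2 * 1"
      using assms by (intro mult_strict_left_mono frac_lt_1) auto
    then show ?thesis by (auto simp: f_def floor_less_iff)
  qed
  have "card (f ` ({..N} \<times> {..N})) \<le> card {0..<int (N^2)}"
    using f by (intro card_mono) auto
  also have "\<dots> < card ({..N} \<times> {..N})" by (simp add: power2_eq_square nat_mult_distrib)
  finally have "\<not> inj_on f ({..N} \<times> {..N})" by (rule pigeonhole)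
  then obtain i j i' j' where ij: "(i, j) \<noteq> (i', j')" "i \<le> N" "j \<le> N" "i' \<le> N" "j' \<le> N"
    and eq: "f (i, j) = f (i', j')"
    by (auto simp: inj_on_def)
  define b where "b = (int i - int i', int j - int j', \<lfloor>g (i', j')\<rfloor> - \<lfloor>g (i, j)\<rfloor>)"
  have "dot_star b x = frac (g (i, j)) - frac (g (i', j'))"
    by (simp add: b_def x frac_def g_def algebra_simps)
  moreover have "\<bar>real N ^ 2 * frac (g (i, j)) - real N ^ 2 * frac (g (i', j'))\<bar> < 1"
    using eq unfolding f_def by linarith
  ultimately have "real N ^ 2 * \<bar>dot_star b x\<bar> < 1"
    by (simp add: abs_mult flip: right_diff_distrib)
  then have "\<bar>dot_star b x\<bar> < 1 / real N ^ 2"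
    using assms by (simp add: field_simps)
  moreover have "0 < max_norm (hat b)" "max_norm (hat b) \<le> int N"
    using ij by (auto simp: b_def)
  ultimately show ?thesis by (rule that[rotated -1])
qed

lemma best_approximation_seq_norm_ge:
  assumes "best_approximation_seq x q"
  shows "int k \<le> max_norm (hat (q k))"
proof (induction k)
  case (Suc k)
  have "max_norm (hat (q k)) < max_norm (hat (q (Suc k)))"
    using assms by (auto simp: best_approximation_seq_def strict_mono_Suc_iff)
  with Suc show ?case by linarith
qed (simp add: max_norm_nonneg)

text \<open>Some best approximation no longer than \<open>b\<close> does at least as well as
  \<open>b\<close>; it is \<open>q j\<close> up to sign, and its norm forces
  \<open>j \<le> k\<close>.\<close>

lemma best_approximation_seq_next:
  assumes "best_approximation_seq x q" "0 < max_norm (hat b)"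
    and "max_norm (hat b) < max_norm (hat (q (Suc k)))"
  shows "\<bar>dot_star (q k) x\<bar> \<le> \<bar>dot_star b x\<bar>"
proof -
  have mono: "strict_mono (\<lambda>k. max_norm (hat (q k)))" and best: "\<And>k. best_approximation x (q k)"
    using assms(1) by (auto simp: best_approximation_seq_def)
  obtain p where p: "best_approximation x p" "max_norm (hat p) \<le> max_norm (hat b)"
    "\<bar>dot_star p x\<bar> \<le> \<bar>dot_star b x\<bar>"
    using ex_best_approximation_le[OF assms(2)] .
  then obtain j where j: "p = q j \<or> p = - q j"
    using assms(1) unfolding best_approximation_seq_def by blast
  then have "max_norm (hat (q j)) < max_norm (hat (q (Suc k)))"
    using p(2) assms(3) by auto
  then have "j < Suc k" using strict_mono_less[OF mono] by auto
  then have "max_norm (hat (q j)) \<le> max_norm (hat (q k))"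
    using strict_mono_less_eq[OF mono] by auto
  then have "\<bar>dot_star (q k) x\<bar> \<le> \<bar>dot_star (q j) x\<bar>"
    using best best_approximationD by blast
  also have "\<dots> = \<bar>dot_star p x\<bar>" using j by auto
  finally show ?thesis using p(3) by simp
qed

text \<open>The determinant of the two integer pairs equals \<open>a' * D - a * D'\<close>. The
  first product strictly dominates, so this integer is nonzero and at most
  \<open>2 * \<bar>a' * D\<bar>\<close> in absolute value.\<close>

lemma rational_approximation_gap:
  fixes a a' c c' :: int and \<xi> D D' :: real
  defines "D \<equiv> a * \<xi> + c" and "D' \<equiv> a' * \<xi> + c'"
  assumes "\<bar>a\<bar> < \<bar>a'\<bar>" "\<bar>D'\<bar> \<le> \<bar>D\<bar>" "D \<noteq> 0"
  shows "1 \<le> 2 * \<bar>a'\<bar> * \<bar>D\<bar>"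
proof -
  have det: "a' * D - a * D' = of_int (a' * c - a * c')"
    by (simp add: D_def D'_def algebra_simps)
  have *: "\<bar>a * D'\<bar> < \<bar>a' * D\<bar>"
  proof -
    have "\<bar>real_of_int a\<bar> * \<bar>D'\<bar> \<le> \<bar>real_of_int a\<bar> * \<bar>D\<bar>"
      using assms by (intro mult_left_mono) auto
    also have "\<dots> < \<bar>real_of_int a'\<bar> * \<bar>D\<bar>"
      using assms(3,5) by (intro mult_strict_right_mono) auto
    finally show ?thesis by (simp add: abs_mult)
  qed
  then have "a' * c - a * c' \<noteq> 0" using det by (metis less_irrefl of_int_0 right_minus_eq)
  then have "1 \<le> \<bar>a' * D - a * D'\<bar>" unfolding det by linarith
  also have "\<dots> \<le> 2 * \<bar>a' * D\<bar>" using * by linarith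
  finally show ?thesis by (simp add: abs_mult)
qed

lemma best_approximation_seq_alternates:
  assumes irr: "totally_irrational x" and seq: "best_approximation_seq x q" and k: "4 \<le> k"
    and H: "q k \<in> H1 \<union> H2" "q (Suc k) \<in> H1 \<union> H2"
  shows "(q k \<in> H1 \<and> q (Suc k) \<in> H2) \<or> (q k \<in> H2 \<and> q (Suc k) \<in> H1)"
proof (rule ccontr)
  assume neg: "\<not> ?thesis"
  obtain s t where x: "x = (s, t)" by (cases x)
  define n where "n = max_norm (hat (q (Suc k)))"
  define D where "D = dot_star (q k) x"
  \<comment> \<open>Norms grow at least as fast as indices. From \<open>n = 4\<close> on, the final
    inequality \<open>(n - 1)^2 < 2 * n\<close> is impossible.\<close>
  have n4: "4 \<le> n" using best_approximation_seq_norm_ge[OF seq, of "Suc k"] k by (simp add: n_def)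
  have pos: "0 < max_norm (hat (q k))"
    using seq best_approximationD(1) unfolding best_approximation_seq_def by blast
  have less: "max_norm (hat (q k)) < n"
    using seq by (auto simp: best_approximation_seq_def strict_mono_Suc_iff n_def)
  have D0: "D \<noteq> 0"
    using irr pos unfolding D_def totally_irrational_def by (cases "q k") (auto simp: zero_prod_def)
  have le: "\<bar>dot_star (q (Suc k)) x\<bar> \<le> \<bar>D\<bar>"
    unfolding D_def using seq pos less
    by (intro best_approximationD(2)) (auto simp: best_approximation_seq_def n_def)
  have "1 \<le> 2 * of_int n * \<bar>D\<bar>"
  proof -
    obtain a b c where q: "q k = (a, b, c)" by (cases "q k")
    obtain a' b' c' where q': "q (Suc k) = (a', b', c')" by (cases "q (Suc k)")
    consider "b = 0" "b' = 0" | "a = 0" "a' = 0"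
      using H neg by (auto simp: H1_def H2_def q q')
    then show ?thesis
    proof cases
      case 1
      then show ?thesis
        using rational_approximation_gap[of a a' s c' c] le D0 less
        by (simp add: D_def q q' x n_def)
    next
      case 2
      then show ?thesis
        using rational_approximation_gap[of b b' t c' c] le D0 less
        by (simp add: D_def q q' x n_def)
    qed
  qed
  moreover have "\<bar>D\<bar> < 1 / real (nat (n - 1)) ^ 2"
  proof -
    obtain b where b: "0 < max_norm (hat b)" "max_norm (hat b) \<le> int (nat (n - 1))"
      "\<bar>dot_star b x\<bar> < 1 / real (nat (n - 1)) ^ 2"
      \<comment> \<open>\<open>n - 1\<close> is the largest bound that keeps the Dirichlet vector
        shorter than \<open>q (Suc k)\<close>, so that it cannot beat \<open>q k\<close>.\<close>
      using dirichlet_linear_form[of "nat (n - 1)" x] n4 by auto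
    have "\<bar>D\<bar> \<le> \<bar>dot_star b x\<bar>"
      unfolding D_def using b n4 by (intro best_approximation_seq_next[OF seq]) (auto simp: n_def)
    with b show ?thesis by linarith
  qed
  ultimately have "real (nat (n - 1)) ^ 2 < 2 * of_int n"
  proof -
    assume 1: "1 \<le> 2 * of_int n * \<bar>D\<bar>" and 2: "\<bar>D\<bar> < 1 / real (nat (n - 1)) ^ 2"
    have "1 \<le> 2 * of_int n * \<bar>D\<bar>" by (fact 1)
    also have "\<dots> < 2 * of_int n * (1 / real (nat (n - 1)) ^ 2)"
      using n4 2 by (intro mult_strict_left_mono) auto
    finally show ?thesis using n4 by (simp add: field_simps)
  qed
  then have "real_of_int ((n - 1) ^ 2) < real_of_int (2 * n)" using n4 by simp
  then have "(n - 1) ^ 2 < 2 * n" by (simp only: of_int_less_iff)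
  then have "n * (n - 4) < 0" by (simp add: power2_eq_square algebra_simps)
  with n4 show False by (simp add: mult_less_0_iff)
qed

lemma special_points_alternate:
  assumes "x \<in> special_points" "best_approximation_seq x q"
  shows "\<exists>N. \<forall>k\<ge>N. (q k \<in> H1 \<and> q (Suc k) \<in> H2) \<or> (q k \<in> H2 \<and> q (Suc k) \<in> H1)"
proof -
  obtain q' N where irr: "totally_irrational x" and q': "best_approximation_seq x q'"
    and N: "\<And>k. k \<ge> N \<Longrightarrow> q' k \<in> H1 \<union> H2"
    using assms(1) by (auto simp: special_points_def)
  \<comment> \<open>Membership in the planes is known for the tail of \<open>q'\<close> only. As
    \<open>q k\<close> has norm at least \<open>k\<close>, every \<open>k \<ge> M\<close> makes
    \<open>q k\<close> equal up to sign to some \<open>q' j\<close> with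
    \<open>j \<ge> N\<close>.\<close>
  define M where "M = nat (max_norm (hat (q' N)))"
  have tail: "q k \<in> H1 \<union> H2" if "k \<ge> M" for k
  proof -
    obtain j where j: "q k = q' j \<or> q k = - q' j"
      using q' assms(2) unfolding best_approximation_seq_def by blast
    have "max_norm (hat (q' N)) \<le> int k" using that by (simp add: M_def)
    also have "\<dots> \<le> max_norm (hat (q k))" by (rule best_approximation_seq_norm_ge[OF assms(2)])
    also have "\<dots> = max_norm (hat (q' j))" using j by auto
    finally have "max_norm (hat (q' N)) \<le> max_norm (hat (q' j))" .
    moreover have "strict_mono (\<lambda>k. max_norm (hat (q' k)))"
      using q' by (simp add: best_approximation_seq_def)
    ultimately have "N \<le> j" using strict_mono_less_eq by blast
    with j N[of j] H12_uminus[of "q' j"] show ?thesis by auto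
  qed
  have "(q k \<in> H1 \<and> q (Suc k) \<in> H2) \<or> (q k \<in> H2 \<and> q (Suc k) \<in> H1)" if "k \<ge> M + 4" for k
    using that by (intro best_approximation_seq_alternates[OF irr assms(2)] tail) auto
  then show ?thesis by blast
qed

text \<open>Enumerate the infinite set of norms of best approximations and choose one vector for
  each; total irrationality makes that choice unique up to sign.\<close>

lemma ex_best_approximation_seq:
  assumes irr: "totally_irrational x"
    and unbounded: "\<And>n. \<exists>p. best_approximation x p \<and> n \<le> max_norm (hat p)"
  obtains q where "best_approximation_seq x q"
proof -
  define S where "S = {n. \<exists>p. best_approximation x p \<and> max_norm (hat p) = int n}"
  have "infinite S"
    unfolding infinite_nat_iff_unbounded_le
  proof
    fix m
    obtain p where p: "best_approximation x p" "int m \<le> max_norm (hat p)"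
      using unbounded by blast
    then have "nat (max_norm (hat p)) \<in> S"
      unfolding S_def mem_Collect_eq by (metis max_norm_nonneg nat_0_le)
    with p(2) show "\<exists>n\<ge>m. n \<in> S" by (intro exI[of _ "nat (max_norm (hat p))"]) auto
  qed
  then have "\<forall>k. \<exists>p. best_approximation x p \<and> max_norm (hat p) = int (enumerate S k)"
    using enumerate_in_set[OF \<open>infinite S\<close>] unfolding S_def by blast
  then obtain q where q: "\<And>k. best_approximation x (q k)"
    "\<And>k. max_norm (hat (q k)) = int (enumerate S k)"
    by metis
  have "best_approximation_seq x q"
    unfolding best_approximation_seq_def
  proof (intro conjI allI impI)
    show "strict_mono (\<lambda>k. max_norm (hat (q k)))"
      using strict_mono_enumerate[OF \<open>infinite S\<close>] by (auto simp: q strict_mono_def)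
  next
    fix p assume p: "best_approximation x p"
    then have "nat (max_norm (hat p)) \<in> S"
      unfolding S_def mem_Collect_eq by (metis max_norm_nonneg nat_0_le)
    from enumerate_Ex[OF \<open>infinite S\<close> this]
    obtain k where "enumerate S k = nat (max_norm (hat p))" ..
    then have "max_norm (hat p) = max_norm (hat (q k))" by (simp add: q max_norm_nonneg)
    then show "\<exists>k. p = q k \<or> p = - q k"
      using best_approximation_unique[OF irr p q(1)] by blast
  qed (rule q)
  then show ?thesis by (rule that)
qed

subsection \<open>Interleaved sequences of convergents\<close>

text \<open>By the determinant condition, \<open>p j / q j - p 0 / q 0\<close> are the partial sums
  of an alternating series with terms \<open>1 / (q j * q (j + 1))\<close>. Leibniz's criterion
  gives the limit and the side on which each partial sum lies.\<close>

lemma ex_alternating_limit: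
  fixes q p :: "nat \<Rightarrow> int"
  assumes pos: "\<And>j. 0 < q j" and grow: "\<And>j. int j \<le> q j" and mono: "\<And>j. q j \<le> q (Suc j)"
    and det: "\<And>j. q j * p (Suc j) - q (Suc j) * p j = (- 1) ^ j"
  shows "\<exists>\<xi>::real. \<forall>j. 0 \<le> (- 1) ^ j * (q j * \<xi> - p j)"
proof -
  define a where "a = (\<lambda>j. 1 / (real_of_int (q j) * real_of_int (q (Suc j))))"
  have a0: "0 \<le> a j" for j using pos[of j] pos[of "Suc j"] by (simp add: a_def)
  have a_le: "a (Suc j) \<le> a j" for j
  proof -
    have "real_of_int (q j) * real_of_int (q (Suc j))
      \<le> real_of_int (q (Suc j)) * real_of_int (q (Suc (Suc j)))"
      using pos[of j] pos[of "Suc j"] pos[of "Suc (Suc j)"] mono[of j] mono[of "Suc j"]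
      by (intro mult_mono) auto
    then show ?thesis
      unfolding a_def using pos[of j] pos[of "Suc j"] pos[of "Suc (Suc j)"]
      by (intro divide_left_mono mult_pos_pos) auto
  qed
  have a_lim: "a \<longlonglongrightarrow> 0"
  proof (rule tendsto_sandwich[where f = "\<lambda>_. 0"])
    show "\<forall>\<^sub>F j in sequentially. a j \<le> 1 / real (Suc j)"
    proof (rule eventuallyI)
      fix j
      have "1 * real (Suc j) \<le> real_of_int (q j) * real_of_int (q (Suc j))"
        using pos[of j] grow[of "Suc j"] by (intro mult_mono) auto
      then show "a j \<le> 1 / real (Suc j)" unfolding a_def by (intro divide_left_mono) auto
    qed
    show "(\<lambda>j. 1 / real (Suc j)) \<longlonglongrightarrow> 0" using LIMSEQ_Suc[OF lim_1_over_n] by simp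
  qed (auto simp: a0)
  define s where "s = (\<Sum>j. (- 1) ^ j * a j)"
  have partial: "(\<Sum>i<j. (- 1) ^ i * a i) = p j / q j - p 0 / q 0" for j
  proof (induction j)
    case (Suc j)
    have "(- 1) ^ j * a j = p (Suc j) / q (Suc j) - p j / q j"
      using pos[of j] pos[of "Suc j"] arg_cong[OF det[of j], of real_of_int]
      by (simp add: a_def field_simps)
    with Suc show ?case by simp
  qed simp
  define \<xi> where "\<xi> = p 0 / q 0 + s"
  have "0 \<le> (- 1) ^ j * (q j * \<xi> - p j)" for j
  proof -
    have "0 \<le> (- 1) ^ j * (\<xi> - p j / q j)"
    proof (cases "even j")
      case True
      then obtain n where "j = 2 * n" by blast
      with summable_Leibniz'(2)[OF a_lim a0 a_le, of n] show ?thesis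
        by (simp add: \<xi>_def s_def partial)
    next
      case False
      then obtain n where "j = 2 * n + 1" using oddE by blast
      with summable_Leibniz'(4)[OF a_lim a0 a_le, of n] show ?thesis
        by (simp add: \<xi>_def s_def partial del: sum.lessThan_Suc)
    qed
    then have "0 \<le> real_of_int (q j) * ((- 1) ^ j * (\<xi> - p j / q j))"
      by (rule mult_nonneg_nonneg[rotated]) (use pos[of j] in simp)
    also have "\<dots> = (- 1) ^ j * (q j * \<xi> - p j)"
      using pos[of j] by (simp add: field_simps)
    finally show ?thesis .
  qed
  then show ?thesis by blast
qed

text \<open>Terms of equal parity form one chain of convergents \<open>P k / X k\<close>, in which
  \<open>k div 2\<close> is the position. \<open>X_mono\<close> is not strict because the
  construction below starts with \<open>X 0 = X 1 = 1\<close>.\<close>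

locale interleaved_denominators =
  fixes X P :: "nat \<Rightarrow> int"
  assumes X_pos: "0 < X k"
    and X_mono: "X k \<le> X (Suc k)"
    and X_coprime: "coprime (X k) (X (Suc k))"
    and X_growth: "3 * X (Suc k) ^ 2 \<le> X (Suc (Suc k))"
    and det: "X k * P (k + 2) - X (k + 2) * P k = (- 1) ^ (k div 2)"
begin

lemma X_ge_1: "1 \<le> X k"
  using X_pos[of k] by linarith

lemma X_triple: "3 * X (Suc k) \<le> X (Suc (Suc k))"
proof -
  have "X (Suc k) * 1 \<le> X (Suc k) * X (Suc k)"
    using X_ge_1[of "Suc k"] by (intro mult_left_mono) auto
  then show ?thesis using X_growth[of k] by (simp add: power2_eq_square)
qed

lemma X_ge: "int k \<le> X k"
proof (induction k)
  case (Suc k)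
  show ?case
  proof (cases k)
    case 0
    then show ?thesis using X_ge_1[of 1] by simp
  next
    case (Suc m)
    then show ?thesis using X_triple[of m] X_ge_1[of k] \<open>int k \<le> X k\<close> by simp
  qed
qed (simp add: less_imp_le X_pos)

lemma mono_X: "mono X"
  using X_mono by (simp add: mono_iff_le_Suc)

lemma coprime_PX: "coprime (P k) (X k)"
proof (rule coprimeI)
  fix c assume "c dvd P k" "c dvd X k"
  then have "c dvd X k * P (k + 2) - X (k + 2) * P k" by simp
  then have "c dvd (- 1) ^ (k div 2)" unfolding det .
  then show "is_unit c" by (cases "even (k div 2)") auto
qed

lemma ex_limits: "\<exists>\<xi> :: nat \<Rightarrow> real. \<forall>k. 0 \<le> (- 1) ^ (k div 2) * (X k * \<xi> (k mod 2) - P k)"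
proof -
  have "\<exists>\<xi> :: real. \<forall>j. 0 \<le> (- 1) ^ j * (X (2 * j + r) * \<xi> - P (2 * j + r))" if "r < 2" for r
  proof (rule ex_alternating_limit)
    fix j
    show "int j \<le> X (2 * j + r)" using X_ge[of "2 * j + r"] by simp
    show "X (2 * j + r) \<le> X (2 * Suc j + r)" by (intro monoD[OF mono_X]) auto
    show "X (2 * j + r) * P (2 * Suc j + r) - X (2 * Suc j + r) * P (2 * j + r) = (- 1) ^ j"
    proof -
      have "(2 * j + r) div 2 = j" using that by simp
      with det[of "2 * j + r"] show ?thesis by (simp add: add_ac)
    qed
  qed (rule X_pos)
  then have "\<exists>\<xi> :: nat \<Rightarrow> real. \<forall>r<2. \<forall>j. 0 \<le> (- 1) ^ j * (X (2 * j + r) * \<xi> r - P (2 * j + r))"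
    by metis
  then obtain \<xi> :: "nat \<Rightarrow> real"
    where "\<And>r j. r < 2 \<Longrightarrow> 0 \<le> (- 1) ^ j * (X (2 * j + r) * \<xi> r - P (2 * j + r))"
    by blast
  from this[of "k mod 2" "k div 2" for k] show ?thesis by auto
qed

end

section \<open>The constructed point and its best approximations\<close>

text \<open>Indexing the two reals by parity treats even and odd \<open>k\<close> together:
  \<open>\<xi> (k mod 2)\<close> belongs to the \<open>k\<close>-th vector,
  \<open>\<xi> (Suc k mod 2)\<close> is the other coordinate.\<close>

locale interleaved_convergents = interleaved_denominators +
  fixes \<xi> :: "nat \<Rightarrow> real"
  assumes sign: "0 \<le> (- 1) ^ (k div 2) * (X k * \<xi> (k mod 2) - P k)"
begin

definition \<delta> :: "nat \<Rightarrow> real" where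
  "\<delta> k = \<bar>X k * \<xi> (k mod 2) - P k\<bar>"

definition conv :: "nat \<Rightarrow> int \<times> int \<times> int" where
  "conv k = (if even k then (X k, 0, - P k) else (0, X k, - P k))"

abbreviation point :: "real \<times> real" where
  "point \<equiv> (\<xi> 0, \<xi> (Suc 0))"

lemma \<delta>_eq: "\<delta> k = (- 1) ^ (k div 2) * (X k * \<xi> (k mod 2) - P k)"
  using sign[of k] by (cases "even (k div 2)") (auto simp: \<delta>_def)

lemma \<delta>_nonneg: "0 \<le> \<delta> k"
  by (simp add: \<delta>_def)

text \<open>Consecutive convergents of one chain lie on opposite sides of the limit, so their
  absolute errors add up in the determinant identity.\<close>

lemma \<delta>_sum: "X (k + 2) * \<delta> k + X k * \<delta> (k + 2) = 1"
proof -
  have "(k + 2) mod 2 = k mod 2" "(k + 2) div 2 = Suc (k div 2)" by simp_all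
  then have "X (k + 2) * \<delta> k + X k * \<delta> (k + 2)
      = (- 1) ^ (k div 2) * of_int (X k * P (k + 2) - X (k + 2) * P k)"
    unfolding \<delta>_eq by (simp add: algebra_simps)
  also have "\<dots> = 1" unfolding det by (simp flip: power_mult_distrib)
  finally show ?thesis .
qed

lemma \<delta>_le: "\<delta> k \<le> 1 / X (k + 2)"
proof -
  have "0 \<le> X k * \<delta> (k + 2)" using X_pos[of k] \<delta>_nonneg by simp
  then have "X (k + 2) * \<delta> k \<le> 1" using \<delta>_sum[of k] by linarith
  then show ?thesis using X_pos[of "k + 2"] by (simp add: field_simps)
qed

text \<open>In the identity \<open>\<delta>_sum\<close> the second summand is at most
  \<open>X k / X (k + 4)\<close>, hence at most \<open>1 / 2\<close>.\<close>

lemma \<delta>_ge: "1 / (2 * X (k + 2)) \<le> \<delta> k"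
proof -
  have "X k * \<delta> (k + 2) \<le> X k * (1 / X (k + 4))"
    using \<delta>_le[of "k + 2"] X_pos[of k] by (intro mult_left_mono) (auto simp: numeral_eq_Suc)
  also have "\<dots> \<le> 1 / 2"
  proof -
    have "X k \<le> X (k + 3)" by (intro monoD[OF mono_X]) auto
    then have "2 * X k \<le> X (k + 4)"
      using X_triple[of "k + 2"] X_pos[of "k + 3"] by (simp add: numeral_eq_Suc)
    then have "2 * real_of_int (X k) \<le> real_of_int (X (k + 4))" by linarith
    then show ?thesis using X_pos[of "k + 4"] by (simp add: field_simps)
  qed
  finally have "1 / 2 \<le> X (k + 2) * \<delta> k" using \<delta>_sum[of k] by linarith
  then show ?thesis using X_pos[of "k + 2"] by (simp add: field_simps)
qed

lemma \<delta>_pos: "0 < \<delta> k"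
proof -
  have "0 < 1 / (2 * real_of_int (X (k + 2)))" using X_pos by simp
  with \<delta>_ge[of k] show ?thesis by linarith
qed

text \<open>Classical optimality of convergents: in the basis of two consecutive convergent vectors
  the coefficients of \<open>(u, -z)\<close> have opposite signs, and so have the two errors, so the
  contributions add up.\<close>

lemma one_dim_best:
  assumes u: "u \<noteq> 0" "\<bar>u\<bar> < X (k + 2)"
  shows "\<delta> k \<le> \<bar>of_int u * \<xi> (k mod 2) + of_int z\<bar>"
proof -
  define e :: int where "e = (- 1) ^ (k div 2)"
  \<comment> \<open>Cramer's rule for \<open>(u, -z) = m (X k, P k) + n (X (k + 2), P (k + 2))\<close>.\<close>
  define m where "m = e * (u * P (k + 2) + z * X (k + 2))"
  define n where "n = - e * (z * X k + u * P k)"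
  have e: "e * e = 1" by (simp add: e_def flip: power_mult_distrib)
  have det': "X k * P (k + 2) = X (k + 2) * P k + e" using det[of k] by (simp add: e_def)
  have u_eq: "u = m * X k + n * X (k + 2)"
  proof -
    have "m * X k + n * X (k + 2) = e * u * (X k * P (k + 2) - X (k + 2) * P k)"
      by (simp add: m_def n_def algebra_simps)
    also have "\<dots> = u" using det' e by (simp add: algebra_simps)
    finally show ?thesis ..
  qed
  have z_eq: "z = - m * P k - n * P (k + 2)"
  proof -
    have "- m * P k - n * P (k + 2) = e * z * (X k * P (k + 2) - X (k + 2) * P k)"
      by (simp add: m_def n_def algebra_simps)
    also have "\<dots> = z" using det' e by (simp add: algebra_simps)
    finally show ?thesis ..
  qed
  define x where "x = \<xi> (k mod 2)"
  have x2: "x = \<xi> ((k + 2) mod 2)" by (simp add: x_def)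
  have "of_int u * x + of_int z = of_int m * (X k * x - P k) + of_int n * (X (k + 2) * x - P (k + 2))"
    by (subst u_eq, subst z_eq) (simp add: algebra_simps)
  also have "X k * x - P k = e * \<delta> k" 
    using e unfolding \<delta>_eq x_def e_def by (simp flip: power_mult_distrib mult.assoc)
  also have "X (k + 2) * x - P (k + 2) = - e * \<delta> (k + 2)"
    using e unfolding \<delta>_eq x2 e_def by (simp flip: power_mult_distrib mult.assoc)
  finally have "of_int u * x + of_int z = e * (of_int m * \<delta> k - of_int n * \<delta> (k + 2))"
    by (simp add: algebra_simps)
  moreover have "\<bar>real_of_int e\<bar> = 1" by (simp add: e_def)
  ultimately have abs: "\<bar>of_int u * x + of_int z\<bar> = \<bar>of_int m * \<delta> k - of_int n * \<delta> (k + 2)\<bar>"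
    by (simp add: abs_mult)
  have "m \<noteq> 0"
  proof
    assume "m = 0"
    then have "X (k + 2) dvd u" using u_eq by simp
    then show False using u zdvd_imp_le[of "X (k + 2)" "\<bar>u\<bar>"] by simp
  qed
  \<comment> \<open>Nonzero coefficients of equal sign would give
    \<open>\<bar>u\<bar> \<ge> X (k + 2)\<close>.\<close>
  have "(1 \<le> m \<and> n \<le> 0) \<or> (m \<le> - 1 \<and> 0 \<le> n)"
  proof (rule ccontr)
    assume neg: "\<not> ?thesis"
    then consider "1 \<le> m" "1 \<le> n" | "m \<le> - 1" "n \<le> - 1" using \<open>m \<noteq> 0\<close> by linarith
    then show False
    proof cases
      case 1
      then have "0 \<le> m * X k" "1 * X (k + 2) \<le> n * X (k + 2)"
        using X_pos[of k] X_pos[of "k + 2"] by (auto intro!: mult_right_mono)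
      then show False using u_eq u by linarith
    next
      case 2
      then have "m * X k \<le> 0 * X k" "n * X (k + 2) \<le> - 1 * X (k + 2)"
        using X_pos[of k] X_pos[of "k + 2"] by (intro mult_right_mono; linarith)+
      then show False using u_eq u by linarith
    qed
  qed
  then have "\<delta> k \<le> \<bar>of_int m * \<delta> k - of_int n * \<delta> (k + 2)\<bar>"
  proof
    assume mn: "1 \<le> m \<and> n \<le> 0"
    then have "1 * \<delta> k \<le> of_int m * \<delta> k" "of_int n * \<delta> (k + 2) \<le> 0 * \<delta> (k + 2)"
      using \<delta>_nonneg by (intro mult_right_mono; simp)+
    then show ?thesis by linarith
  next
    assume mn: "m \<le> - 1 \<and> 0 \<le> n"
    then have "of_int m \<le> (- 1 :: real)" by linarith
    then have "of_int m * \<delta> k \<le> - 1 * \<delta> k" by (rule mult_right_mono) (rule \<delta>_nonneg)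
    moreover have "0 \<le> of_int n * \<delta> (k + 2)" using mn \<delta>_nonneg by simp
    ultimately show ?thesis by linarith
  qed
  with abs show ?thesis by (simp add: x_def)
qed

text \<open>With \<open>S\<close> the value of the form, \<open>a * b * S\<close> differs from the
  nonzero integer \<open>m\<close> by two errors of at most \<open>b^2 / c \<le> 1 / 3\<close> each.
  So \<open>\<bar>a * b * S\<bar> \<ge> 1 / 3\<close>, whence \<open>\<bar>S\<bar> \<ge> 1 / (3 *
  b^2) \<ge> 1 / c \<ge> \<delta> k\<close>; the factor 3 in \<open>X_growth\<close> serves both
  ends.\<close>

lemma mixed_bound:
  assumes u: "\<bar>u\<bar> < X (Suc k)" and v: "v \<noteq> 0" "\<bar>v\<bar> < X (Suc k)"
  shows "\<delta> k \<le> \<bar>of_int u * \<xi> (k mod 2) + of_int v * \<xi> (Suc k mod 2) + of_int z\<bar>"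
proof -
  define a b c d :: real where "a = X k" "b = X (Suc k)" "c = X (k + 2)" "d = X (k + 3)"
  have pos: "0 < a" "0 < b" "0 < c" "0 < d" and le: "a \<le> b" "c \<le> d"
    using X_pos X_mono[of k] X_mono[of "k + 2"]
    by (auto simp: a_b_c_d_def numeral_eq_Suc)
  have c_ge: "3 * (b * b) \<le> c"
    using of_int_le_iff[where 'a = real, THEN iffD2, OF X_growth[of k]]
    by (simp add: a_b_c_d_def power2_eq_square)
  \<comment> \<open>The numerator over \<open>X k * X (Suc k)\<close> after both reals are replaced
    by their convergents.\<close>
  define m where "m = u * P k * X (Suc k) + v * P (Suc k) * X k + z * X k * X (Suc k)"
  have "m \<noteq> 0"
  proof
    assume "m = 0"
    then have "v * P (Suc k) * X k = X (Suc k) * (- u * P k - z * X k)"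
      by (simp add: m_def algebra_simps)
    then have "X (Suc k) dvd v * P (Suc k) * X k" by simp
    then have "X (Suc k) dvd v"
      using coprime_PX[of "Suc k"] X_coprime[of k]
      by (simp add: coprime_dvd_mult_left_iff coprime_commute)
    then show False using v zdvd_imp_le[of "X (Suc k)" "\<bar>v\<bar>"] by simp
  qed
  then have "1 \<le> \<bar>real_of_int m\<bar>" by linarith
  define S where "S = of_int u * \<xi> (k mod 2) + of_int v * \<xi> (Suc k mod 2) + of_int z"
  define r where "r = X k * \<xi> (k mod 2) - P k"
  define r' where "r' = X (Suc k) * \<xi> (Suc k mod 2) - P (Suc k)"
  have m_eq: "real_of_int m = a * b * S - (of_int u * b * r + of_int v * a * r')"
    by (simp add: m_def a_b_c_d_def S_def r_def r'_def algebra_simps)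
  have ru: "\<bar>of_int u * b * r\<bar> \<le> b * b * (1 / c)"
  proof -
    have "\<bar>r\<bar> \<le> 1 / c" using \<delta>_le[of k] by (simp add: r_def \<delta>_def a_b_c_d_def)
    moreover have "\<bar>real_of_int u\<bar> \<le> b" using u by (simp add: a_b_c_d_def)
    ultimately show ?thesis using pos by (simp only: abs_mult) (intro mult_mono, auto)
  qed
  have rv: "\<bar>of_int v * a * r'\<bar> \<le> b * b * (1 / c)"
  proof -
    have "\<bar>r'\<bar> \<le> 1 / d"
      using \<delta>_le[of "Suc k"] by (simp add: r'_def \<delta>_def a_b_c_d_def numeral_eq_Suc)
    also have "\<dots> \<le> 1 / c" using pos le by (simp add: frac_le)
    finally have "\<bar>r'\<bar> \<le> 1 / c" .
    moreover have "\<bar>real_of_int v\<bar> \<le> b" using v by (simp add: a_b_c_d_def)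
    ultimately show ?thesis using pos le by (simp only: abs_mult) (intro mult_mono, auto)
  qed
  have "b * b * (1 / c) \<le> 1 / 3" using c_ge pos by (simp add: field_simps)
  with ru rv m_eq \<open>1 \<le> \<bar>real_of_int m\<bar>\<close> have "1 / 3 \<le> \<bar>a * b * S\<bar>" by linarith
  also have "\<dots> \<le> b * b * \<bar>S\<bar>"
    using pos le by (simp add: abs_mult mult_right_mono)
  finally have "1 / (3 * (b * b)) \<le> \<bar>S\<bar>" using pos by (simp add: field_simps)
  moreover have "1 / c \<le> 1 / (3 * (b * b))" using c_ge pos by (intro divide_left_mono) auto
  moreover have "\<delta> k \<le> 1 / c" using \<delta>_le[of k] by (simp add: a_b_c_d_def)
  ultimately show ?thesis unfolding S_def by linarith
qed

lemma dot_star_ge: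
  assumes b: "0 < max_norm (hat b)" "max_norm (hat b) < X (Suc k)"
  shows "\<delta> k \<le> \<bar>dot_star b point\<bar>"
proof -
  have main: "\<delta> k \<le> \<bar>of_int u * \<xi> (k mod 2) + of_int v * \<xi> (Suc k mod 2) + of_int z\<bar>"
    if "\<bar>u\<bar> < X (Suc k)" "\<bar>v\<bar> < X (Suc k)" "u \<noteq> 0 \<or> v \<noteq> 0" for u v z
  proof (cases "v = 0")
    case True
    with that X_mono[of "Suc k"] one_dim_best[of u k z] show ?thesis by simp
  next
    case False
    with that mixed_bound[of u k v z] show ?thesis by simp
  qed
  obtain x y z where xyz: "b = (x, y, z)" by (cases b)
  have xy: "\<bar>x\<bar> < X (Suc k)" "\<bar>y\<bar> < X (Suc k)" "x \<noteq> 0 \<or> y \<noteq> 0" using b by (auto simp: xyz)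
  show ?thesis
  proof (cases "even k")
    case True
    then have "k mod 2 = 0" "Suc k mod 2 = Suc 0" by presburger+
    then show ?thesis using main[of x y z] xy by (simp add: xyz)
  next
    case False
    then have "k mod 2 = Suc 0" "Suc k mod 2 = 0" by presburger+
    \<comment> \<open>For odd \<open>k\<close> the two coordinates exchange roles.\<close>
    then show ?thesis using main[of y x z] xy by (auto simp: xyz add_ac)
  qed
qed

lemma max_norm_conv: "max_norm (hat (conv k)) = X k"
  using X_pos[of k] by (simp add: conv_def)

lemma abs_dot_star_conv: "\<bar>dot_star (conv k) point\<bar> = \<delta> k"
proof (cases "even k")
  case True
  then have "k mod 2 = 0" by presburger
  with True show ?thesis by (simp add: conv_def \<delta>_def)
next
  case False
  then have "k mod 2 = Suc 0" by presburger
  with False show ?thesis by (simp add: conv_def \<delta>_def)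
qed

lemma conv_in_H: "conv k \<in> H1 \<union> H2"
  by (auto simp: conv_def H1_def H2_def)

lemma min_value_eq:
  fixes Q :: real
  assumes "X k \<le> Q" "Q < X (Suc k)"
  shows "min_value point Q = \<delta> k"
proof (rule antisym)
  show "min_value point Q \<le> \<delta> k"
    using min_value_le[of "conv k" Q point] assms X_pos
    by (simp add: max_norm_conv abs_dot_star_conv)
  show "\<delta> k \<le> min_value point Q"
  proof (rule min_value_greatest)
    show "1 \<le> Q" using X_ge_1[of k] assms by linarith
  qed (use assms in \<open>auto intro!: dot_star_ge\<close>)
qed

lemma totally_irrational_point: "totally_irrational point"
  unfolding totally_irrational_def
proof (intro allI impI)
  fix b :: "int \<times> int \<times> int" assume "b \<noteq> 0"
  show "dot_star b point \<noteq> 0"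
  proof (cases "0 < max_norm (hat b)")
    case True
    \<comment> \<open>\<open>X (Suc k) \<ge> k + 1\<close> puts \<open>b\<close> in the range of
      \<open>dot_star_ge\<close>, whose bound is positive. If \<open>hat b\<close> vanishes, the
      form is just the third coordinate.\<close>
    define k where "k = nat (max_norm (hat b))"
    have "max_norm (hat b) < X (Suc k)" using X_ge[of "Suc k"] True by (simp add: k_def)
    from dot_star_ge[OF True this] \<delta>_pos[of k] show ?thesis by auto
  next
    case False
    then have "max_norm (hat b) = 0" using max_norm_nonneg[of "hat b"] by linarith
    with \<open>b \<noteq> 0\<close> show ?thesis by (cases b) (auto simp: zero_prod_def max_def split: if_splits)
  qed
qed

lemma between_X:
  assumes "X 0 \<le> n"
  obtains k where "X k \<le> n" "n < X (Suc k)"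
proof -
  define k where "k = (LEAST k. n < X k)"
  have "n < X (Suc (nat n))" using X_ge[of "Suc (nat n)"] by linarith
  then have "n < X k" unfolding k_def by (rule LeastI)
  with assms obtain j where j: "k = Suc j" by (cases k) auto
  have "\<not> n < X j" unfolding k_def[symmetric] using not_less_Least[of j "\<lambda>k. n < X k"] j k_def by simp
  with \<open>n < X k\<close> j that[of j] show ?thesis by auto
qed

text \<open>The index starts at 1 because \<open>X 0 = X 1\<close> is allowed, which makes the first
  interval empty; later terms increase strictly.\<close>

lemma best_approximation_conv: "best_approximation point (conv (Suc k))"
  unfolding best_approximation_def max_norm_conv abs_dot_star_conv
proof
  show "0 < X (Suc k)" by (rule X_pos)
  then have "X (Suc k) < X (Suc (Suc k))" using X_triple[of k] by linarith
  then show "\<delta> (Suc k) = min_value point (X (Suc k))" by (intro min_value_eq[symmetric]) auto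
qed

text \<open>The minimal value is constant between consecutive terms of \<open>X\<close>, so
  \<open>p\<close> and \<open>conv k\<close> have equal absolute values and agree up to
  sign.\<close>

lemma best_approximation_imp_conv:
  assumes "best_approximation point p" "X 0 \<le> max_norm (hat p)"
  obtains k where "p = conv k \<or> p = - conv k"
proof -
  obtain k where "X k \<le> max_norm (hat p)" "max_norm (hat p) < X (Suc k)"
    using between_X[OF assms(2)] .
  then have "\<bar>dot_star p point\<bar> = \<bar>dot_star (conv k) point\<bar>"
    using assms(1) min_value_eq[of k "max_norm (hat p)"]
    by (simp add: best_approximation_def abs_dot_star_conv)
  from totally_irrational_abs_eq[OF totally_irrational_point this] that show ?thesis by blast
qed

lemma point_special: "point \<in> special_points"
proof -
  have "\<exists>p. best_approximation point p \<and> n \<le> max_norm (hat p)" for n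
  proof (intro exI conjI)
    show "best_approximation point (conv (Suc (nat n)))" by (rule best_approximation_conv)
    show "n \<le> max_norm (hat (conv (Suc (nat n))))"
      using X_ge[of "Suc (nat n)"] unfolding max_norm_conv by linarith
  qed
  then obtain q where q: "best_approximation_seq point q"
    using ex_best_approximation_seq[OF totally_irrational_point] by blast
  have "q k \<in> H1 \<union> H2" if "nat (X 0) \<le> k" for k
  proof -
    have "best_approximation point (q k)" using q by (simp add: best_approximation_seq_def)
    moreover have "X 0 \<le> max_norm (hat (q k))"
      using that best_approximation_seq_norm_ge[OF q, of k] by linarith
    ultimately obtain j where "q k = conv j \<or> q k = - conv j"
      by (rule best_approximation_imp_conv)
    then show ?thesis using conv_in_H[of j] H12_uminus[of "conv j"] by auto
  qed
  with q totally_irrational_point show ?thesis unfolding special_points_def by blast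
qed

subsection \<open>The uniform exponent\<close>

text \<open>For \<open>Q\<close> between \<open>X k\<close> and \<open>X (Suc k)\<close> the product
  is at most \<open>X (Suc k) powr t / X (k + 2)\<close>, which is eventually at most 1.\<close>

lemma uniform_exponent_ge:
  assumes t: "0 < t" and le: "\<forall>\<^sub>F k in sequentially. X (Suc k) powr t \<le> X (k + 2)"
  shows "ereal t \<le> uniform_exponent point"
proof -
  obtain K where K: "\<And>k. K \<le> k \<Longrightarrow> X (Suc k) powr t \<le> X (k + 2)"
    using le by (auto simp: eventually_sequentially)
  have "Q powr t * min_value point Q \<le> 1" if Q: "X K \<le> Q" for Q :: real
  proof -
    have "X 0 \<le> X K" by (intro monoD[OF mono_X]) auto
    with Q have "X 0 \<le> \<lfloor>Q\<rfloor>" by linarith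
    then obtain k where "X k \<le> \<lfloor>Q\<rfloor>" "\<lfloor>Q\<rfloor> < X (Suc k)" by (rule between_X)
    then have k: "X k \<le> Q" "Q < X (Suc k)" by linarith+
    then have "X K < X (Suc k)" using Q by linarith
    then have "K \<le> k" using monoD[OF mono_X, of "Suc k" K] by linarith
    have "0 \<le> Q" using Q X_pos[of K] by linarith
    have "Q powr t * min_value point Q \<le> X (Suc k) powr t * (1 / X (k + 2))"
      unfolding min_value_eq[OF k] using k \<open>0 \<le> Q\<close> t \<delta>_nonneg
      by (intro mult_mono powr_mono2 \<delta>_le) auto
    also have "\<dots> \<le> 1" using K[OF \<open>K \<le> k\<close>] X_pos[of "k + 2"] by (simp add: field_simps)
    finally show ?thesis .
  qed
  then have "\<forall>\<^sub>F Q in at_top. ereal (Q powr t * min_value point Q) \<le> 1"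
    using eventually_mono[OF eventually_ge_at_top[of "real_of_int (X K)"]] by simp
  then have "Limsup at_top (\<lambda>Q::real. ereal (Q powr t * min_value point Q)) \<le> 1"
    by (rule Limsup_bounded)
  then have "Limsup at_top (\<lambda>Q::real. ereal (Q powr t * min_value point Q)) < \<infinity>"
    by (rule order.strict_trans1) simp
  then show ?thesis unfolding uniform_exponent_def using t by (intro Sup_upper) auto
qed

text \<open>Near the right end of such an interval the product is, up to a constant factor, at least
  \<open>X (Suc k) powr t / X (k + 2)\<close>, which is unbounded for \<open>t > w\<close>.\<close>

lemma uniform_exponent_le:
  assumes w: "\<And>t. w < t \<Longrightarrow> filterlim (\<lambda>k. X (Suc k) powr t / X (k + 2)) at_top sequentially"
  shows "uniform_exponent point \<le> ereal w"
  unfolding uniform_exponent_def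
proof (rule Sup_least, safe)
  fix t :: real
  assume "0 < t" and "Limsup at_top (\<lambda>Q::real. ereal (Q powr t * min_value point Q)) < \<infinity>"
  then obtain C :: nat where "Limsup at_top (\<lambda>Q::real. ereal (Q powr t * min_value point Q)) < ereal C"
    using less_PInf_Ex_of_nat by auto
  then have "\<forall>\<^sub>F Q in at_top. ereal (Q powr t * min_value point Q) < ereal C"
    by (rule Limsup_lessD)
  then obtain Q0 where Q0: "\<And>Q::real. Q0 \<le> Q \<Longrightarrow> Q powr t * min_value point Q < C"
    by (auto simp: eventually_at_top_linorder)
  show "ereal t \<le> ereal w"
  proof (rule ccontr)
    assume "\<not> ereal t \<le> ereal w"
    \<comment> \<open>The factor \<open>2 powr t\<close> pays for
      \<open>Q \<ge> X (Suc k) / 2\<close>, the factor 2 for the lower bound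
      \<open>\<delta>_ge\<close>.\<close>
    then have "\<forall>\<^sub>F k in sequentially. C * 2 * 2 powr t \<le> X (Suc k) powr t / X (k + 2)"
      using w[of t] by (simp add: filterlim_at_top)
    then obtain K where K: "\<And>k. K \<le> k \<Longrightarrow> C * 2 * 2 powr t \<le> X (Suc k) powr t / X (k + 2)"
      by (auto simp: eventually_sequentially)
    define k where "k = max K (max 1 (nat \<lceil>Q0\<rceil>))"
    have k: "C * 2 * 2 powr t \<le> X (Suc k) powr t / X (k + 2)" by (rule K) (simp add: k_def)
    have k': "1 \<le> k" "nat \<lceil>Q0\<rceil> \<le> k" unfolding k_def by linarith+
    obtain j where j: "k = Suc j" using k'(1) by (cases k) auto
    \<comment> \<open>The last integer before the minimal value drops from \<open>\<delta> k\<close>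
      to \<open>\<delta> (Suc k)\<close>.\<close>
    define Q where "Q = real_of_int (X (Suc k) - 1)"
    have X: "3 * X k \<le> X (Suc k)" "1 \<le> X k" using X_triple[of j] X_ge_1 by (simp_all add: j)
    then have "real_of_int (X k) \<le> Q" "Q < X (Suc k)" "X (Suc k) / 2 \<le> Q"
      unfolding Q_def by linarith+
    note Q = this
    have "Q0 \<le> Q" using X_ge[of "Suc k"] k'(2) unfolding Q_def by linarith
    have "C \<le> (X (Suc k) powr t / X (k + 2)) / (2 * 2 powr t)"
      using k by (subst pos_le_divide_eq) (auto simp: mult.assoc)
    also have "\<dots> = (X (Suc k) / 2) powr t * (1 / (2 * X (k + 2)))"
      using X by (simp add: powr_divide)
    also have "\<dots> \<le> Q powr t * \<delta> k"
      using Q X \<open>0 < t\<close> X_pos[of "k + 2"] by (intro mult_mono powr_mono2 \<delta>_ge) auto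
    also have "\<dots> = Q powr t * min_value point Q" using Q by (simp add: min_value_eq)
    also have "\<dots> < C" by (rule Q0) fact
    finally show False by simp
  qed
qed

end

subsection \<open>Denominators of prescribed growth\<close>

lemma ex_congruent_in_window:
  fixes a b c T :: int
  assumes "0 < b" "0 < c" "coprime b c"
  shows "\<exists>n. T \<le> n \<and> n \<le> T + b * c \<and> b dvd n - a \<and> c dvd n - 1"
proof -
  obtain u v where uv: "u * b + v * c = 1"
    using bezout_int[of b c] assms(3) by auto
  \<comment> \<open>Chinese remainders: \<open>m\<close> is \<open>a\<close> modulo
    \<open>b\<close>, and 1 modulo \<open>c\<close> because \<open>u * b\<close> is 1 there.
    Reduction modulo \<open>b * c\<close> then moves it into the window starting at
    \<open>T\<close>.\<close>
  define m where "m = a + b * u * (1 - a)"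
  define n where "n = T + (m - T) mod (b * c)"
  have bc: "0 < b * c" using assms by simp
  have n: "n = m - (b * c) * ((m - T) div (b * c))"
    using minus_div_mult_eq_mod[of "m - T" "b * c"] by (simp add: n_def algebra_simps)
  have "T \<le> n" using pos_mod_sign[OF bc, of "m - T"] by (simp add: n_def)
  moreover have "n \<le> T + b * c" using pos_mod_bound[OF bc, of "m - T"] by (simp add: n_def)
  moreover have "n - a = b * (u * (1 - a) - c * ((m - T) div (b * c)))"
    by (simp add: n m_def algebra_simps)
  moreover have "n - 1 = c * ((a - 1) * v - b * ((m - T) div (b * c)))"
  proof -
    have "m - 1 = (a - 1) * (1 - u * b)" by (simp add: m_def algebra_simps)
    also have "\<dots> = (a - 1) * (v * c)" using uv by (metis add_diff_cancel_left')
    finally show ?thesis by (simp add: n algebra_simps)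
  qed
  ultimately show ?thesis by (metis dvd_triv_left)
qed

text \<open>The congruence modulo \<open>b\<close> continues the chain of convergents of equal
  parity; the one modulo \<open>c\<close> ensures coprimality with the predecessor
  \<open>c\<close>.\<close>

definition next_denominator :: "int \<Rightarrow> int \<Rightarrow> int \<Rightarrow> int \<Rightarrow> int" where
  "next_denominator T a b c = (SOME n. T \<le> n \<and> n \<le> T + b * c \<and> b dvd n - a \<and> c dvd n - 1)"

lemma next_denominator:
  assumes "0 < b" "0 < c" "coprime b c"
  shows "T \<le> next_denominator T a b c" "next_denominator T a b c \<le> T + b * c"
    "b dvd next_denominator T a b c - a" "c dvd next_denominator T a b c - 1"
  using someI_ex[OF ex_congruent_in_window[OF assms, of T a]]
  unfolding next_denominator_def by blast+

text \<open>\<open>T k n\<close> is the size aimed at after a term \<open>n\<close>. The values 1,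
  1, 3, 28 satisfy the growth condition (\<open>28 \<ge> 3 * 3^2\<close>) and are consecutively
  coprime.\<close>

fun denominator :: "(nat \<Rightarrow> int \<Rightarrow> int) \<Rightarrow> nat \<Rightarrow> int" where
  "denominator T 0 = 1"
| "denominator T (Suc 0) = 1"
| "denominator T (Suc (Suc 0)) = 3"
| "denominator T (Suc (Suc (Suc 0))) = 28"
| "denominator T (Suc (Suc (Suc (Suc k)))) =
     next_denominator (T k (denominator T (Suc (Suc (Suc k)))))
       (denominator T k) (denominator T (Suc (Suc k))) (denominator T (Suc (Suc (Suc k))))"

text \<open>The continued fraction recurrence, with the partial quotient read off from the
  denominators; the congruence makes the division exact.\<close>

fun numerator :: "(nat \<Rightarrow> int \<Rightarrow> int) \<Rightarrow> nat \<Rightarrow> int" where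
  "numerator T 0 = 0"
| "numerator T (Suc 0) = 0"
| "numerator T (Suc (Suc 0)) = 1"
| "numerator T (Suc (Suc (Suc 0))) = 1"
| "numerator T (Suc (Suc (Suc (Suc k)))) =
     (denominator T (Suc (Suc (Suc (Suc k)))) - denominator T k) div denominator T (Suc (Suc k))
       * numerator T (Suc (Suc k)) + numerator T k"

text \<open>Four terms at once, since the recursion reaches back four places, and positivity
  together with coprimality, since the properties of \<open>next_denominator\<close> rest on
  both.\<close>

lemma denominator_invariant:
  assumes T: "\<And>k n. 3 * n ^ 2 \<le> T k n"
  shows "0 < denominator T k \<and> 0 < denominator T (Suc k) \<and> 0 < denominator T (Suc (Suc k)) \<and>
    0 < denominator T (Suc (Suc (Suc k))) \<and>
    coprime (denominator T (Suc (Suc k))) (denominator T (Suc (Suc (Suc k))))"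
proof (induction k)
  case 0
  have "coprime 3 (28 :: int)"
  proof (rule coprimeI)
    fix d :: int assume "d dvd 3" "d dvd 28"
    then have "d dvd 28 - 9 * 3" by (intro dvd_diff dvd_mult)
    then show "is_unit d" by simp
  qed
  then show ?case by simp
next
  case (Suc k)
  define b c where "b = denominator T (Suc (Suc k))" and "c = denominator T (Suc (Suc (Suc k)))"
  define n where "n = denominator T (Suc (Suc (Suc (Suc k))))"
  have n: "n = next_denominator (T k c) (denominator T k) b c"
    by (simp add: n_def b_def c_def)
  have bc: "0 < b" "0 < c" "coprime b c" using Suc by (auto simp: b_def c_def)
  have "0 < 3 * c ^ 2" using bc by simp
  also have "\<dots> \<le> n" using T[of c k] next_denominator(1)[OF bc] unfolding n by (rule order_trans)
  finally have "0 < n" .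
  have "coprime c n"
  proof (rule coprimeI)
    fix d assume "d dvd c" "d dvd n"
    moreover have "c dvd n - 1" unfolding n by (rule next_denominator(4)[OF bc])
    ultimately have "d dvd n - (n - 1)" by (meson dvd_diff dvd_trans)
    then show "is_unit d" by simp
  qed
  with Suc \<open>0 < n\<close> show ?case unfolding n_def c_def by blast
qed

lemma denominator_step:
  assumes T: "\<And>k n. 3 * n ^ 2 \<le> T k n"
  defines "X \<equiv> denominator T"
  shows "T k (X (Suc (Suc (Suc k)))) \<le> X (Suc (Suc (Suc (Suc k))))"
    and "X (Suc (Suc (Suc (Suc k)))) \<le>
      T k (X (Suc (Suc (Suc k)))) + X (Suc (Suc k)) * X (Suc (Suc (Suc k)))"
    and "X (Suc (Suc k)) dvd X (Suc (Suc (Suc (Suc k)))) - X k"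
proof -
  have bc: "0 < X (Suc (Suc k))" "0 < X (Suc (Suc (Suc k)))"
    "coprime (X (Suc (Suc k))) (X (Suc (Suc (Suc k))))"
    using denominator_invariant[of T k] T by (auto simp: X_def)
  note * = next_denominator[OF bc, of "T k (X (Suc (Suc (Suc k))))" "X k"]
  show "T k (X (Suc (Suc (Suc k)))) \<le> X (Suc (Suc (Suc (Suc k))))"
    "X (Suc (Suc (Suc (Suc k)))) \<le>
      T k (X (Suc (Suc (Suc k)))) + X (Suc (Suc k)) * X (Suc (Suc (Suc k)))"
    "X (Suc (Suc k)) dvd X (Suc (Suc (Suc (Suc k)))) - X k"
    using * by (simp_all add: X_def)
qed

lemma denominator_interleaved:
  assumes T: "\<And>k n. 3 * n ^ 2 \<le> T k n"
  shows "interleaved_denominators (denominator T) (numerator T)"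
proof
  fix k
  note inv = denominator_invariant[of T, OF T]
  show "0 < denominator T k" using inv by blast
  show growth: "3 * denominator T (Suc k) ^ 2 \<le> denominator T (Suc (Suc k))" for k
  proof -
    consider "k = 0" | "k = 1" | j where "k = Suc (Suc j)" 
      by (metis One_nat_def not0_implies_Suc)
    then show ?thesis
    proof cases
      case (3 j)
      show ?thesis
        unfolding 3 by (rule order_trans[OF T denominator_step(1)[of T, OF T]])
    qed simp_all
  qed
  show "denominator T k \<le> denominator T (Suc k)"
  proof (cases k)
    case (Suc j)
    have "denominator T k * 1 \<le> denominator T k * denominator T k"
      using inv[of k] by (intro mult_left_mono) auto
    also have "\<dots> \<le> 3 * denominator T k ^ 2" by (simp add: power2_eq_square)
    also have "\<dots> \<le> denominator T (Suc k)" using growth[of j] Suc by simp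
    finally show ?thesis by simp
  qed simp
  show "coprime (denominator T k) (denominator T (Suc k))"
  proof -
    consider "k = 0" | "k = 1" | j where "k = Suc (Suc j)" 
      by (metis One_nat_def not0_implies_Suc)
    then show ?thesis using inv by cases auto
  qed
  show "denominator T k * numerator T (k + 2) - denominator T (k + 2) * numerator T k
    = (- 1) ^ (k div 2)"
  \<comment> \<open>Steps of two stay within one parity; the common partial quotient cancels, so the
    determinant only changes sign.\<close>
  proof (induction k rule: induct_nat_012)
    case (ge2 k)
    define a b n where "a = denominator T k" "b = denominator T (Suc (Suc k))"
      "n = denominator T (Suc (Suc (Suc (Suc k))))"
    have "b dvd n - a" using denominator_step(3)[of T, OF T] by (simp add: a_b_n_def)
    then obtain m where m: "n - a = b * m" ..
    have "b \<noteq> 0" using inv[of k] by (simp add: a_b_n_def)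
    then have num: "numerator T (Suc (Suc (Suc (Suc k)))) = m * numerator T (Suc (Suc k)) + numerator T k"
      using m by (simp add: a_b_n_def del: denominator.simps)
    have "b * numerator T (Suc (Suc (Suc (Suc k)))) - n * numerator T (Suc (Suc k))
      = - (a * numerator T (Suc (Suc k)) - b * numerator T k)"
      using m unfolding num by (simp add: algebra_simps)
    also have "\<dots> = - ((- 1) ^ (k div 2))" using ge2(1) by (simp add: a_b_n_def)
    finally show ?case by (simp add: a_b_n_def del: denominator.simps numerator.simps)
  qed (simp_all add: numeral_eq_Suc)
qed

section \<open>Special points with prescribed exponent\<close>

lemma ex_special_point:
  fixes e :: "nat \<Rightarrow> real"
  assumes e: "\<And>k. 2 \<le> e k"
  obtains X P :: "nat \<Rightarrow> int" and \<xi> :: "nat \<Rightarrow> real" where "interleaved_convergents X P \<xi>"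
    and "\<And>k. X (k + 3) powr e k \<le> X (k + 4)" and "\<And>k. X (k + 4) \<le> 6 * X (k + 3) powr e k"
proof -
  \<comment> \<open>The square secures \<open>X_growth\<close>, the power sets the size. The window
    adds at most \<open>c^2\<close>, and \<open>1 \<le> c^2 \<le> c powr e k\<close>, from
    \<open>2 \<le> e k\<close>, bounds the total by \<open>6 * c powr e k\<close>.\<close>
  define T where "T = (\<lambda>k (n::int). 3 * n ^ 2 + \<lceil>of_int n powr e k\<rceil>)"
  have T: "3 * n ^ 2 \<le> T k n" for k n
    using powr_ge_zero[of "real_of_int n" "e k"] unfolding T_def by linarith
  interpret interleaved_denominators "denominator T" "numerator T"
    by (rule denominator_interleaved) (rule T)
  obtain \<xi> :: "nat \<Rightarrow> real" where
    "\<forall>k. 0 \<le> (- 1) ^ (k div 2) * (denominator T k * \<xi> (k mod 2) - numerator T k)"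
    using ex_limits by blast
  then have "interleaved_convergents (denominator T) (numerator T) \<xi>"
    by unfold_locales blast
  moreover have "denominator T (k + 3) powr e k \<le> denominator T (k + 4)" (is ?lower)
    and "denominator T (k + 4) \<le> 6 * denominator T (k + 3) powr e k" (is ?upper) for k
  proof -
    define b c n where "b = denominator T (k + 2)" "c = denominator T (k + 3)"
      "n = denominator T (k + 4)"
    have c: "1 \<le> c" "b \<le> c" using X_ge_1 X_mono[of "k + 2"] by (simp_all add: b_c_n_def numeral_eq_Suc)
    have lo: "T k c \<le> n" and up: "n \<le> T k c + b * c"
      using denominator_step[of T k, OF T] by (simp_all add: b_c_n_def numeral_eq_Suc)
    have "real_of_int c powr e k \<le> T k c" unfolding T_def by (simp add: add_increasing)
    also have "\<dots> \<le> n" using lo by simp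
    finally show ?lower by (simp add: b_c_n_def)
    have sq: "real_of_int c ^ 2 \<le> c powr e k"
      using c e[of k] powr_mono[of 2 "e k" "real_of_int c"] by simp
    have one: "1 \<le> real_of_int c ^ 2" using c by simp
    have "b * c \<le> c ^ 2" using c by (simp add: power2_eq_square mult_right_mono)
    then have "n \<le> 4 * c ^ 2 + \<lceil>of_int c powr e k\<rceil>" using up by (simp add: T_def)
    then have "real_of_int n \<le> of_int (4 * c ^ 2 + \<lceil>of_int c powr e k\<rceil>)" by (simp only: of_int_le_iff)
    also have "\<dots> \<le> 4 * of_int c ^ 2 + (of_int c powr e k + 1)" by simp
    also have "\<dots> \<le> 6 * of_int c powr e k" using sq one by linarith
    finally show ?upper by (simp add: b_c_n_def)
  qed
  ultimately show ?thesis by (rule that)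
qed

lemma ex_special_point_exponent_real:
  assumes w: "2 \<le> w"
  shows "\<exists>x\<in>special_points. uniform_exponent x = ereal w"
proof -
  obtain X P :: "nat \<Rightarrow> int" and \<xi> :: "nat \<Rightarrow> real" where "interleaved_convergents X P \<xi>"
    and lower: "\<And>k. X (k + 3) powr w \<le> X (k + 4)" and upper: "\<And>k. X (k + 4) \<le> 6 * X (k + 3) powr w"
    using ex_special_point[of "\<lambda>_. w"] w by metis
  then interpret interleaved_convergents X P \<xi> by simp
  have shift: "X (Suc k) powr w \<le> X (k + 2)" "X (k + 2) \<le> 6 * X (Suc k) powr w" if "2 \<le> k" for k
    using lower[of "k - 2"] upper[of "k - 2"] that by (simp_all add: numeral_eq_Suc Suc_diff_Suc)
  have "ereal w \<le> uniform_exponent point"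
    using w shift by (intro uniform_exponent_ge) (auto simp: eventually_sequentially)
  moreover have "uniform_exponent point \<le> ereal w"
  proof (rule uniform_exponent_le)
    fix t assume t: "w < t"
    \<comment> \<open>For \<open>t > w\<close> the upper bound on \<open>X (k + 2)\<close> leaves at
      least \<open>X (Suc k) powr (t - w) / 6\<close>, and \<open>X (Suc k) \<ge> k\<close>.\<close>
    have "filterlim (\<lambda>k. real k powr (t - w) / 6) at_top sequentially"
      using t by real_asymp
    then show "filterlim (\<lambda>k. X (Suc k) powr t / X (k + 2)) at_top sequentially"
    proof (rule filterlim_at_top_mono)
      show "\<forall>\<^sub>F k in sequentially. real k powr (t - w) / 6 \<le> X (Suc k) powr t / X (k + 2)"
        using eventually_ge_at_top[of 2]
      proof eventually_elim
        case (elim k)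
        have "real k powr (t - w) / 6 \<le> X (Suc k) powr (t - w) / 6"
          using X_ge[of "Suc k"] t by (intro divide_right_mono powr_mono2) auto
        also have "\<dots> = X (Suc k) powr t / (6 * X (Suc k) powr w)"
          by (simp add: powr_diff)
        also have "\<dots> \<le> X (Suc k) powr t / X (k + 2)"
          using shift(2)[OF elim] X_pos[of "k + 2"] X_pos[of "Suc k"]
          by (intro divide_left_mono mult_pos_pos) auto
        finally show ?case .
      qed
    qed
  qed
  ultimately show ?thesis using point_special by (intro bexI[of _ point] antisym)
qed

lemma ex_special_point_exponent_infinity:
  "\<exists>x\<in>special_points. uniform_exponent x = \<infinity>"
proof -
  obtain X P :: "nat \<Rightarrow> int" and \<xi> :: "nat \<Rightarrow> real" where "interleaved_convergents X P \<xi>"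
    and lower: "\<And>k. X (k + 3) powr (real k + 2) \<le> X (k + 4)"
    \<comment> \<open>Exponents tending to infinity eventually exceed every \<open>t\<close>; after
      the index shift by 2, the exponent between \<open>X (Suc k)\<close> and
      \<open>X (k + 2)\<close> is \<open>k\<close>.\<close>
    using ex_special_point[of "\<lambda>k. real k + 2"] by (metis le_add_same_cancel2 of_nat_0_le_iff)
  then interpret interleaved_convergents X P \<xi> by simp
  have ge: "ereal t \<le> uniform_exponent point" if "0 < t" for t
  proof (rule uniform_exponent_ge[OF that])
    have "X (Suc k) powr t \<le> X (k + 2)" if "max 2 (nat \<lceil>t\<rceil>) \<le> k" for k
    proof -
      have k: "2 \<le> k" "t \<le> real k" using that by linarith+
      have "X (Suc k) powr t \<le> X (Suc k) powr real k"
        using k X_ge_1[of "Suc k"] by (intro powr_mono) auto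
      also have "\<dots> \<le> X (k + 2)"
        using lower[of "k - 2"] k by (simp add: numeral_eq_Suc Suc_diff_Suc of_nat_diff)
      finally show ?thesis .
    qed
    then show "\<forall>\<^sub>F k in sequentially. X (Suc k) powr t \<le> X (k + 2)"
      unfolding eventually_sequentially by blast
  qed
  have "uniform_exponent point = \<infinity>"
  proof (rule ereal_top)
    fix B :: real
    have "ereal B \<le> ereal (max B 1)" by simp
    also have "\<dots> \<le> uniform_exponent point" by (rule ge) simp
    finally show "ereal B \<le> uniform_exponent point" .
  qed
  with point_special show ?thesis by blast
qed

lemma ex_special_point_exponent:
  assumes "2 \<le> (w :: ereal)"
  shows "\<exists>x\<in>special_points. uniform_exponent x = w"
  using assms ex_special_point_exponent_real ex_special_point_exponent_infinity by (cases w) auto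

theorem theorem9:
  shows "uncountable special_points \<and>
    (\<forall>x\<in>special_points. \<forall>q. best_approximation_seq x q \<longrightarrow>
       (\<exists>N. \<forall>k\<ge>N. (q k \<in> H1 \<and> q (Suc k) \<in> H2) \<or> (q k \<in> H2 \<and> q (Suc k) \<in> H1))) \<and>
    (\<forall>w::ereal. 2 \<le> w \<longrightarrow> (\<exists>x\<in>special_points. uniform_exponent x = w))"
proof (intro conjI ballI allI impI)
  show "uncountable special_points"
  proof
    assume "countable special_points"
    then have "countable (uniform_exponent ` special_points)" by simp
    moreover have "ereal ` {2..3} \<subseteq> uniform_exponent ` special_points"
    proof
      fix y assume "y \<in> ereal ` {2..3}"
      then have "2 \<le> y" by auto
      from ex_special_point_exponent[OF this] show "y \<in> uniform_exponent ` special_points" by auto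
    qed
    ultimately have "countable (ereal ` {2..3})" using countable_subset by blast
    then have "countable {2..3::real}" by (rule countable_image_inj_on) simp
    then show False using uncountable_closed_interval[of 2 3] by simp
  qed
qed (rule special_points_alternate ex_special_point_exponent; assumption)+

end
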